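(* For the battery charging game with $T>2$ time steps, the price of stability for supply-sign price profiles is $\mathrm{PoS}_{\mathrm{SIGN}}=\infty$.
   Context: **Battery charging game.** An instance consists of: a number of time steps $T\in\mathbb{N}$, with $[T]=\{1,\dots,T\}$; a finite directed graph $H=(V,E)$; for each $t\in[T]$ a copy $H_t=(V_t,E_t)$ of $H$ (the copy of $v\in V$ is $v_t$); a capacity $\kappa(e_t)\ge 0$ for each $e_t\in E_t$; a value $d(v_t)\in\mathbb{R}$ for each $v_t\in V_t$ (positive: supply, negative: demand); a finite set $B$ of battery agents, each $b\in B$ having a location $v^b\in V$, battery nodes $b_1,\dots,b_T$, and battery edges $(b_t,b_{t+1})$, $t\in[T-1]$, with capacities $\kappa((b_t,b_{t+1}))\ge 0$. For each $b,t$ there are two transaction edges $(b_t,v^b_t)$ and $(v^b_t,b_t)$ (with infinite capacity under $\kappa$). The graph $G$ is the union of all $H_t$, all battery nodes, battery edges and transaction edges. In addition there is a source $x$ with edges $(x,v_t)$ of capacity $\max(0,d(v_t))$ and a target $y$ with edges $(v_t,y)$ of capacity $\max(0,-d(v_t))$, for all $v_t\in V_t$, $t\in[T]$. **Strategies.** A strategy of agent $b$ is a vector $s_b=(s_{b,t})_{t\in[T]}\in\mathbb{R}^{[T]}$ (positive entries: charging, negative: discharging) with $0\le\sum_{z=1}^t s_{b,z}\le\kappa((b_t,b_{t+1}))$ for each $t\in[T-1]$. A strategy profile $\mathbf{s}$ consists of one strategy per agent. **Flow.** Given $\mathbf{s}$, $\kappa_{\mathbf{s}}$ is defined by $\kappa_{\mathbf{s}}((v^b_t,b_t))=\max(0,s_{b,t})$,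 $\kappa_{\mathbf{s}}((b_t,v^b_t))=\max(0,-s_{b,t})$, and $\kappa_{\mathbf{s}}=\kappa$ on all other edges; $G_{\mathbf{s}}$ is the graph $G$ (with $x,y$) with capacities $\kappa_{\mathbf{s}}$. Flows are (real-valued) feasible $x$-$y$-flows, the value $|f|$ being the flow out of $x$; a maximum flow is one of maximum value. **Admissibility.** A transaction edge $e$ is admissible for $\mathbf{s}$ if every maximum flow $f$ in $G_{\mathbf{s}}$ saturates it, i.e. $f(e)=\kappa_{\mathbf{s}}(e)$. A strategy $s_b$ is admissible for $\mathbf{s}$ if all transaction edges of agent $b$ are admissible; $\mathbf{s}$ is admissible if all its strategies are. **Utilities.** For a price profile $\mathbf{p}=(p_t)_{t\in[T]}\in\mathbb{R}^{[T]}$, $u_b(\mathbf{s},\mathbf{p})=-\infty$ if $s_b$ is not admissible for $\mathbf{s}$, and $u_b(\mathbf{s},\mathbf{p})=-\sum_{t\in[T]}s_{b,t}p_t$ otherwise. **Nash equilibrium.** $\mathbf{s}$ is a (pure) Nash equilibrium for $\mathbf{p}$ if there is no agent $b$ with a strategy $s'_b$ such that $u_b((s'_b,\mathbf{s}_{-b}),\mathbf{p})>u_b(\mathbf{s},\mathbf{p})$. **Welfare and price of stability.** $W(\mathbf{s})$ is the value of a maximum flow in $G_{\mathbf{s}}$; $\mathrm{OPT}(G)$ is a strategy profile of maximum welfare (over all strategy profiles); $\mathrm{bestNE}(G,\mathbf{p})$ is a Nash equilibrium for $\mathbf{p}$ of maximum welfare (the ratio below is read as the infimum of the ratios over all Nash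 equilibria). For a class $P$ of price profiles (prices may depend on $G$), $$\mathrm{PoS}_P=\sup_G\ \inf_{\mathbf{p}\in P}\frac{W(\mathrm{OPT}(G))}{W(\mathrm{bestNE}(G,\mathbf{p}))},$$ with $G$ ranging over all instances with the given number $T$ of time steps. Conventions: $0/0=1$, $a/0=\infty$ for $a>0$; the infimum is over those $\mathbf{p}\in P$ admitting a Nash equilibrium and the supremum over those $G$ for which such $\mathbf{p}$ exists. **Price classes.** SIGN (supply-sign), depending on the instance: for each $t\in[T]$, $\operatorname{sgn}(p_t)=-\operatorname{sgn}\bigl(\sum_{v_t\in V_t}d(v_t)\bigr)$, where $\operatorname{sgn}(0)=0$. *)

theory Defs
  imports Complex_Main "HOL-Library.Extended_Real"
begin

text \<open>
  Time steps are the elements of \<open>{1..horizon G}\<close>. Functions indexed by time steps, vertices,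
  agents or edges are total; their values outside the respective index sets are irrelevant.
  \<open>bat_cap G b t\<close> is the capacity of the battery edge from \<open>b\<^sub>t\<close> to \<open>b\<^sub>t\<^sub>+\<^sub>1\<close>.
\<close>

record ('v, 'b) battery_game =
  horizon :: nat
  verts :: "'v set"
  arcs :: "('v \<times> 'v) set"
  net_cap :: "nat \<Rightarrow> 'v \<times> 'v \<Rightarrow> real"
  net_val :: "nat \<Rightarrow> 'v \<Rightarrow> real"
  agents :: "'b set"
  loc :: "'b \<Rightarrow> 'v"
  bat_cap :: "'b \<Rightarrow> nat \<Rightarrow> real"

definition battery_instance :: "('v, 'b) battery_game \<Rightarrow> bool" where
  "battery_instance G \<longleftrightarrow>
     finite (verts G) \<and> arcs G \<subseteq> verts G \<times> verts G \<and>
     (\<forall>t\<in>{1..horizon G}. \<forall>e\<in>arcs G. 0 \<le> net_cap G t e) \<and>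
     finite (agents G) \<and> loc G ` agents G \<subseteq> verts G \<and>
     (\<forall>b\<in>agents G. \<forall>t\<in>{1..<horizon G}. 0 \<le> bat_cap G b t)"

datatype ('v, 'b) node = Source | Target | Net 'v nat | Bat 'b nat

type_synonym ('v, 'b) edge = "('v, 'b) node \<times> ('v, 'b) node"

type_synonym 'b profile = "'b \<Rightarrow> nat \<Rightarrow> real"

definition inner_nodes :: "('v, 'b) battery_game \<Rightarrow> ('v, 'b) node set" where
  "inner_nodes G =
     {Net v t | v t. v \<in> verts G \<and> t \<in> {1..horizon G}} \<union>
     {Bat b t | b t. b \<in> agents G \<and> t \<in> {1..horizon G}}"

definition network_edges :: "('v, 'b) battery_game \<Rightarrow> ('v, 'b) edge set" where
  "network_edges G = {(Net u t, Net v t) | u v t. (u, v) \<in> arcs G \<and> t \<in> {1..horizon G}}"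

definition battery_edges :: "('v, 'b) battery_game \<Rightarrow> ('v, 'b) edge set" where
  "battery_edges G = {(Bat b t, Bat b (t + 1)) | b t. b \<in> agents G \<and> t \<in> {1..<horizon G}}"

definition transaction_edges :: "('v, 'b) battery_game \<Rightarrow> 'b \<Rightarrow> ('v, 'b) edge set" where
  "transaction_edges G b =
     {(Net (loc G b) t, Bat b t) | t. t \<in> {1..horizon G}} \<union>
     {(Bat b t, Net (loc G b) t) | t. t \<in> {1..horizon G}}"

definition terminal_edges :: "('v, 'b) battery_game \<Rightarrow> ('v, 'b) edge set" where
  "terminal_edges G =
     {(Source, Net v t) | v t. v \<in> verts G \<and> t \<in> {1..horizon G}} \<union>
     {(Net v t, Target) | v t. v \<in> verts G \<and> t \<in> {1..horizon G}}"

definition edges :: "('v, 'b) battery_game \<Rightarrow> ('v, 'b) edge set" where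
  "edges G = network_edges G \<union> battery_edges G \<union>
     (\<Union>b\<in>agents G. transaction_edges G b) \<union> terminal_edges G"

definition strategy :: "('v, 'b) battery_game \<Rightarrow> 'b \<Rightarrow> (nat \<Rightarrow> real) \<Rightarrow> bool" where
  "strategy G b s \<longleftrightarrow>
     (\<forall>t\<in>{1..<horizon G}. 0 \<le> (\<Sum>z=1..t. s z) \<and> (\<Sum>z=1..t. s z) \<le> bat_cap G b t)"

definition strategy_profile :: "('v, 'b) battery_game \<Rightarrow> 'b profile \<Rightarrow> bool" where
  "strategy_profile G s \<longleftrightarrow> (\<forall>b\<in>agents G. strategy G b (s b))"

text \<open>
  The capacities induced by a profile. The infinite capacities of transaction edges never
  appear, since a profile overrides all of them. The values on pairs outside \<open>edges G\<close> are
  irrelevant.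
\<close>

fun cap :: "('v, 'b) battery_game \<Rightarrow> 'b profile \<Rightarrow> ('v, 'b) edge \<Rightarrow> real" where
  "cap G s (Source, Net v t) = max 0 (net_val G t v)"
| "cap G s (Net v t, Target) = max 0 (- net_val G t v)"
| "cap G s (Net u t, Net v t') = net_cap G t (u, v)"
| "cap G s (Bat b t, Bat b' t') = bat_cap G b t"
| "cap G s (Net v t, Bat b t') = max 0 (s b t')"
| "cap G s (Bat b t, Net v t') = max 0 (- s b t)"
| "cap G s _ = 0"

definition feasible_flow ::
    "('v, 'b) battery_game \<Rightarrow> 'b profile \<Rightarrow> (('v, 'b) edge \<Rightarrow> real) \<Rightarrow> bool" where
  "feasible_flow G s f \<longleftrightarrow>
     (\<forall>e\<in>edges G. 0 \<le> f e \<and> f e \<le> cap G s e) \<and>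
     (\<forall>n\<in>inner_nodes G.
        (\<Sum>e\<in>{e\<in>edges G. snd e = n}. f e) = (\<Sum>e\<in>{e\<in>edges G. fst e = n}. f e))"

definition flow_value :: "('v, 'b) battery_game \<Rightarrow> (('v, 'b) edge \<Rightarrow> real) \<Rightarrow> real" where
  "flow_value G f = (\<Sum>e\<in>{e\<in>edges G. fst e = Source}. f e)"

definition max_flow ::
    "('v, 'b) battery_game \<Rightarrow> 'b profile \<Rightarrow> (('v, 'b) edge \<Rightarrow> real) \<Rightarrow> bool" where
  "max_flow G s f \<longleftrightarrow> is_arg_max (flow_value G) (feasible_flow G s) f"

definition admissible_edge ::
    "('v, 'b) battery_game \<Rightarrow> 'b profile \<Rightarrow> ('v, 'b) edge \<Rightarrow> bool" where
  "admissible_edge G s e \<longleftrightarrow> (\<forall>f. max_flow G s f \<longrightarrow> f e = cap G s e)"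

definition admissible_strategy :: "('v, 'b) battery_game \<Rightarrow> 'b profile \<Rightarrow> 'b \<Rightarrow> bool" where
  "admissible_strategy G s b \<longleftrightarrow> (\<forall>e\<in>transaction_edges G b. admissible_edge G s e)"

definition utility ::
    "('v, 'b) battery_game \<Rightarrow> 'b \<Rightarrow> 'b profile \<Rightarrow> (nat \<Rightarrow> real) \<Rightarrow> ereal" where
  "utility G b s p =
     (if admissible_strategy G s b then ereal (- (\<Sum>t=1..horizon G. s b t * p t)) else - \<infinity>)"

definition nash_equilibrium ::
    "('v, 'b) battery_game \<Rightarrow> (nat \<Rightarrow> real) \<Rightarrow> 'b profile \<Rightarrow> bool" where
  "nash_equilibrium G p s \<longleftrightarrow> strategy_profile G s \<and>
     \<not> (\<exists>b\<in>agents G. \<exists>s'. strategy G b s' \<and> utility G b (s(b := s')) p > utility G b s p)"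

definition welfare :: "('v, 'b) battery_game \<Rightarrow> 'b profile \<Rightarrow> real" where
  "welfare G s = flow_value G (SOME f. max_flow G s f)"

definition opt_profile :: "('v, 'b) battery_game \<Rightarrow> 'b profile" where
  "opt_profile G = (ARG_MAX (welfare G) s. strategy_profile G s)"

definition ratio :: "real \<Rightarrow> real \<Rightarrow> ereal" where
  "ratio a b = (if b = 0 then if a = 0 then 1 else \<infinity> else ereal (a / b))"

definition stable_prices ::
    "(('v, 'b) battery_game \<Rightarrow> (nat \<Rightarrow> real) set) \<Rightarrow> ('v, 'b) battery_game \<Rightarrow> (nat \<Rightarrow> real) set"
  where "stable_prices P G = {p \<in> P G. \<exists>s. nash_equilibrium G p s}"

text \<open>
  The supremum has to range over instances at fixed types; taking vertices and agents to be
  natural numbers loses nothing,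
  since every instance is finite and can be renamed accordingly.
\<close>

definition price_of_stability ::
    "((nat, nat) battery_game \<Rightarrow> (nat \<Rightarrow> real) set) \<Rightarrow> nat \<Rightarrow> ereal" where
  "price_of_stability P T =
     (SUP G \<in> {G. battery_instance G \<and> horizon G = T \<and> stable_prices P G \<noteq> {}}.
        INF p \<in> stable_prices P G.
          INF s \<in> {s. nash_equilibrium G p s}.
            ratio (welfare G (opt_profile G)) (welfare G s))"

definition supply_sign_prices :: "('v, 'b) battery_game \<Rightarrow> (nat \<Rightarrow> real) set" where
  "supply_sign_prices G =
     {p. \<forall>t\<in>{1..horizon G}. sgn (p t) = - sgn (\<Sum>v\<in>verts G. net_val G t v)}"

end

theory Submission
  imports Defs
begin

text \<open>
  One agent at a vertex with supply 1 at time 1 and demand 1 at time 2 can transport this unit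
  and thereby raise the welfare from 0 to 1. A second, isolated vertex has demand 2 at time 1 and
  supply 1 at time 2; it carries no flow, but it forces \<open>p\<^sub>1 > 0\<close> and \<open>p\<^sub>t = 0\<close> for
  \<open>t > 1\<close>. Hence charging at time 1 costs money and discharging never earns any, so that in
  every equilibrium the agent charges nothing at time 1, and the welfare is 0.
\<close>

section \<open>Idleness as a deviation, and welfare, in arbitrary instances\<close>

text \<open>All transaction edges of an idle agent have capacity 0, so every feasible flow saturates
  them.\<close>

lemma idle_admissible:
  assumes "b \<in> agents G" and idle: "s b = (\<lambda>t. 0)"
  shows "admissible_strategy G s b"
  unfolding admissible_strategy_def admissible_edge_def
proof (intro ballI allI impI)
  fix e f
  assume e: "e \<in> transaction_edges G b" and f: "max_flow G s f"
  have "e \<in> edges G"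
    using e assms(1) by (auto simp: edges_def)
  then have "0 \<le> f e" "f e \<le> cap G s e"
    using f by (auto simp: max_flow_def is_arg_max_def feasible_flow_def)
  moreover have "cap G s e = 0"
    using e idle by (auto simp: transaction_edges_def)
  ultimately show "f e = cap G s e"
    by simp
qed

lemma utility_idle:
  assumes "b \<in> agents G"
  shows "utility G b (s(b := (\<lambda>t. 0))) p = 0"
  using idle_admissible[OF assms, of "s(b := (\<lambda>t. 0))"] by (simp add: utility_def)

lemma strategy_idle:
  assumes "battery_instance G" "b \<in> agents G"
  shows "strategy G b (\<lambda>t. 0)"
  using assms by (simp add: battery_instance_def strategy_def)

text \<open>Idling is always open to the agent and yields utility 0. In particular the utility in an
  equilibrium is never -\<infinity>, so equilibrium strategies are admissible.\<close>

lemma nash_equilibrium_utility_nonneg: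
  assumes "battery_instance G" "nash_equilibrium G p s" "b \<in> agents G"
  shows "0 \<le> utility G b s p"
proof -
  have "\<not> utility G b (s(b := (\<lambda>t. 0))) p > utility G b s p"
    using assms strategy_idle[OF assms(1,3)] unfolding nash_equilibrium_def by blast
  then show ?thesis
    using utility_idle[OF assms(3)] by (metis not_less)
qed

text \<open>All maximum flows share one value, so the choice made by \<open>SOME\<close> does not
  matter and exhibiting any maximum flow determines the welfare.\<close>

lemma welfare_eq_flow_value:
  assumes "max_flow G s f"
  shows "welfare G s = flow_value G f"
proof -
  have "max_flow G s (SOME g. max_flow G s g)"
    by (rule someI[of "max_flow G s", OF assms])
  then show ?thesis
    using assms unfolding welfare_def max_flow_def is_arg_max_def by (meson linorder_neqE)
qed

section \<open>The instance and its edges\<close>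

text \<open>The demand 2 outweighs the supply 1 at time 1, while at time 2 supply and demand cancel.
  Capacity 0 of the battery edges from time 2 on forces the battery to be empty again after time
  2.\<close>

definition unprofitable_game :: "nat \<Rightarrow> (nat, nat) battery_game" where
  "unprofitable_game T =
     \<lparr>horizon = T, verts = {0, 1}, arcs = {}, net_cap = (\<lambda>t e. 0),
      net_val = (\<lambda>t v. if t = 1 then (if v = 0 then 1 else - 2)
                       else if t = 2 then (if v = 0 then - 1 else 1) else 0),
      agents = {0}, loc = (\<lambda>b. 0), bat_cap = (\<lambda>b t. if t = 1 then 1 else 0)\<rparr>"

lemma unprofitable_game_simps [simp]:
  "horizon (unprofitable_game T) = T"
  "verts (unprofitable_game T) = {0, 1}"
  "arcs (unprofitable_game T) = {}"
  "agents (unprofitable_game T) = {0}"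
  "loc (unprofitable_game T) b = 0"
  "bat_cap (unprofitable_game T) b t = (if t = 1 then 1 else 0)"
  "net_val (unprofitable_game T) t v =
     (if t = 1 then (if v = 0 then 1 else - 2)
      else if t = 2 then (if v = 0 then - 1 else 1) else 0)"
  by (simp_all add: unprofitable_game_def)

lemma battery_instance_unprofitable_game: "battery_instance (unprofitable_game T)"
  by (simp add: battery_instance_def)

lemmas unprofitable_game_edges =
  edges_def network_edges_def battery_edges_def transaction_edges_def terminal_edges_def

lemma edges_from_Source:
  "{e \<in> edges (unprofitable_game T). fst e = Source} =
     (\<lambda>(v, t). (Source, Net v t)) ` ({0, 1} \<times> {1..T})"
  by (auto simp: unprofitable_game_edges image_iff)

text \<open>Without arcs, a vertex copy meets only terminal edges and, at the agent's location 0,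
  transaction edges.\<close>

lemma edges_into_Net:
  assumes "t \<in> {1..T}"
  shows "{e \<in> edges (unprofitable_game T). snd e = Net 0 t} =
           {(Source, Net 0 t), (Bat 0 t, Net 0 t)}"
    and "{e \<in> edges (unprofitable_game T). snd e = Net (Suc 0) t} = {(Source, Net (Suc 0) t)}"
  using assms by (auto simp: unprofitable_game_edges)

lemma edges_out_of_Net:
  assumes "t \<in> {1..T}"
  shows "{e \<in> edges (unprofitable_game T). fst e = Net 0 t} =
           {(Net 0 t, Target), (Net 0 t, Bat 0 t)}"
    and "{e \<in> edges (unprofitable_game T). fst e = Net (Suc 0) t} = {(Net (Suc 0) t, Target)}"
  using assms by (auto simp: unprofitable_game_edges)

lemma edges_into_Bat:
  assumes "t \<in> {1..T}"
  shows "{e \<in> edges (unprofitable_game T). snd e = Bat 0 t} =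
           insert (Net 0 t, Bat 0 t) (if t = 1 then {} else {(Bat 0 (t - 1), Bat 0 t)})"
  using assms by (auto simp: unprofitable_game_edges)

lemma edges_out_of_Bat:
  assumes "t \<in> {1..T}"
  shows "{e \<in> edges (unprofitable_game T). fst e = Bat 0 t} =
           insert (Bat 0 t, Net 0 t) (if t = T then {} else {(Bat 0 t, Bat 0 (t + 1))})"
  using assms by (auto simp: unprofitable_game_edges)

section \<open>Upper bound on the flow value\<close>

lemma flow_value_unprofitable_game:
  "flow_value (unprofitable_game T) f =
     (\<Sum>t=1..T. f (Source, Net 0 t)) + (\<Sum>t=1..T. f (Source, Net (Suc 0) t))"
proof -
  have "inj_on (\<lambda>(v, t). (Source, Net v t)) ({0, 1} \<times> {1..T})"
    by (auto simp: inj_on_def)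
  then have "flow_value (unprofitable_game T) f =
      (\<Sum>(v, t)\<in>{0, 1} \<times> {1..T}. f (Source, Net v t))"
    unfolding flow_value_def edges_from_Source
    by (subst sum.reindex) (simp_all add: case_prod_unfold o_def del: One_nat_def)
  also have "\<dots> = (\<Sum>v\<in>{0, 1}. \<Sum>t=1..T. f (Source, Net v t))"
    by (rule sum.cartesian_product[symmetric])
  finally show ?thesis
    by simp
qed

text \<open>Only vertex 0 at time 1 can receive flow from the source and pass it on. Its edge to the
  target has capacity 0, so all of this flow must enter the battery.\<close>

lemma flow_value_le_charge:
  assumes "T > 2" and f: "feasible_flow (unprofitable_game T) s f" and "0 \<le> s 0 1"
  shows "flow_value (unprofitable_game T) f \<le> s 0 1"
proof -
  let ?G = "unprofitable_game T"
  have bounds: "0 \<le> f e \<and> f e \<le> cap ?G s e" if "e \<in> edges ?G" for e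
    using f that by (simp add: feasible_flow_def)
  have conservation: "(\<Sum>e\<in>{e\<in>edges ?G. snd e = n}. f e) = (\<Sum>e\<in>{e\<in>edges ?G. fst e = n}. f e)"
    if "n \<in> inner_nodes ?G" for n
    using f that by (simp add: feasible_flow_def)
  \<comment> \<open>What enters from the source leaves directly to the target, and at each time at
    least one of these two edges has capacity 0.\<close>
  have isolated: "f (Source, Net (Suc 0) t) \<le> 0" if t: "t \<in> {1..T}" for t
  proof -
    have "f (Source, Net (Suc 0) t) = f (Net (Suc 0) t, Target)"
      using conservation[of "Net (Suc 0) t"] t
      by (simp add: edges_into_Net[OF t] edges_out_of_Net[OF t] inner_nodes_def)
    moreover have "f (Source, Net (Suc 0) t) \<le> cap ?G s (Source, Net (Suc 0) t)"
      "f (Net (Suc 0) t, Target) \<le> cap ?G s (Net (Suc 0) t, Target)"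
      by (intro bounds[THEN conjunct2]; use t in \<open>simp add: unprofitable_game_edges\<close>)+
    ultimately show ?thesis
      by (cases "t = 1") auto
  qed
  have late: "f (Source, Net 0 t) \<le> 0" if "t \<in> {1<..T}" for t
    using bounds[of "(Source, Net 0 t)"] that
    by (auto simp: unprofitable_game_edges split: if_splits)
  have one: "1 \<in> {1..T}"
    using assms(1) by simp
  have "f (Source, Net 0 1) + f (Bat 0 1, Net 0 1) = f (Net 0 1, Target) + f (Net 0 1, Bat 0 1)"
    using conservation[of "Net 0 1"] one
    by (simp only: edges_into_Net[OF one] edges_out_of_Net[OF one]) (simp add: inner_nodes_def)
  moreover have "0 \<le> f (Bat 0 1, Net 0 1)"
    using bounds[of "(Bat 0 1, Net 0 1)"] one by (simp add: unprofitable_game_edges)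
  moreover have "f (Net 0 1, Target) \<le> 0"
    using bounds[of "(Net 0 1, Target)"] one by (simp add: unprofitable_game_edges)
  moreover have "f (Net 0 1, Bat 0 1) \<le> s 0 1"
    using bounds[of "(Net 0 1, Bat 0 1)"] one assms(3) by (simp add: unprofitable_game_edges)
  ultimately have "f (Source, Net 0 1) \<le> s 0 1"
    by linarith
  moreover have "(\<Sum>t=1..T. f (Source, Net 0 t)) =
      f (Source, Net 0 1) + (\<Sum>t\<in>{1<..T}. f (Source, Net 0 t))"
    using assms(1) by (intro sum.head) simp
  moreover have "(\<Sum>t\<in>{1<..T}. f (Source, Net 0 t)) \<le> 0"
    using late by (rule sum_nonpos)
  moreover have "(\<Sum>t=1..T. f (Source, Net (Suc 0) t)) \<le> 0"
    using isolated by (rule sum_nonpos)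
  ultimately show ?thesis
    unfolding flow_value_unprofitable_game by linarith
qed

section \<open>Welfare equals the charge at time 1\<close>

definition transport_flow :: "real \<Rightarrow> (nat, nat) edge \<Rightarrow> real" where
  "transport_flow c e =
     (if e \<in> {(Source, Net 0 1), (Net 0 1, Bat 0 1), (Bat 0 1, Bat 0 2), (Bat 0 2, Net 0 2),
              (Net 0 2, Target)} then c else 0)"

text \<open>The edges of the path have capacity 1 or \<open>s 0 1\<close>; for the discharging edge
  this is the last assumption.\<close>

lemma transport_flow_feasible:
  assumes "T > 2" "0 \<le> s 0 1" "s 0 1 \<le> 1" "s 0 2 = - s 0 1"
  shows "feasible_flow (unprofitable_game T) s (transport_flow (s 0 1))"
  unfolding feasible_flow_def
proof (intro conjI ballI)
  fix e
  show "0 \<le> transport_flow (s 0 1) e"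
    using assms(2) by (simp add: transport_flow_def)
  assume "e \<in> edges (unprofitable_game T)"
  then have "0 \<le> cap (unprofitable_game T) s e"
    by (auto simp: unprofitable_game_edges)
  moreover have "s 0 1 \<le> cap (unprofitable_game T) s e"
    if "e \<in> {(Source, Net 0 1), (Net 0 1, Bat 0 1), (Bat 0 1, Bat 0 2), (Bat 0 2, Net 0 2),
               (Net 0 2, Target)}"
    using that assms by (elim insertE emptyE) simp_all
  ultimately show "transport_flow (s 0 1) e \<le> cap (unprofitable_game T) s e"
    unfolding transport_flow_def by presburger
next
  let ?G = "unprofitable_game T"
  fix n
  assume "n \<in> inner_nodes ?G"
  then consider t where "t \<in> {1..T}" "n = Net 0 t" | t where "t \<in> {1..T}" "n = Net (Suc 0) t"
    | t where "t \<in> {1..T}" "n = Bat 0 t"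
    by (auto simp: inner_nodes_def)
  then show "(\<Sum>e\<in>{e\<in>edges ?G. snd e = n}. transport_flow (s 0 1) e) =
      (\<Sum>e\<in>{e\<in>edges ?G. fst e = n}. transport_flow (s 0 1) e)"
  proof cases
    case 1
    then show ?thesis
      by (simp add: edges_into_Net edges_out_of_Net transport_flow_def)
  next
    case 2
    then show ?thesis
      by (simp add: edges_into_Net edges_out_of_Net transport_flow_def)
  next
    case 3
    consider "t = 1" | "t = 2" | "2 < t"
      using 3(1) by fastforce
    then show ?thesis
      using 3 assms(1) by cases (simp_all add: edges_into_Bat edges_out_of_Bat transport_flow_def)
  qed
qed

lemma welfare_unprofitable_game:
  assumes "T > 2" "strategy_profile (unprofitable_game T) s"
  shows "welfare (unprofitable_game T) s = s 0 1" and "0 \<le> s 0 1" and "s 0 1 \<le> 1"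
proof -
  let ?G = "unprofitable_game T"
  have "strategy ?G 0 (s 0)"
    using assms(2) by (simp add: strategy_profile_def)
  then have partial: "0 \<le> (\<Sum>z=1..t. s 0 z) \<and> (\<Sum>z=1..t. s 0 z) \<le> (if t = 1 then 1 else 0)"
    if "t \<in> {1..<T}" for t
    using that by (simp add: strategy_def)
  show bounds: "0 \<le> s 0 1" "s 0 1 \<le> 1"
    using partial[of 1] assms(1) by auto
  \<comment> \<open>Here \<open>T > 2\<close> is essential: it makes 2 a constrained time step,
    where the partial sum lies between 0 and the capacity 0.\<close>
  have "s 0 2 = - s 0 1"
    using partial[of 2] assms(1) by (simp add: numeral_2_eq_2)
  then have feasible: "feasible_flow ?G s (transport_flow (s 0 1))"
    using assms(1) bounds by (intro transport_flow_feasible)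
  have "(\<Sum>t=1..T. transport_flow (s 0 1) (Source, Net 0 t)) = s 0 1"
    using assms(1) by (simp add: transport_flow_def)
  then have flow_value: "flow_value ?G (transport_flow (s 0 1)) = s 0 1"
    unfolding flow_value_unprofitable_game by (simp add: transport_flow_def)
  have "max_flow ?G s (transport_flow (s 0 1))"
    unfolding max_flow_def is_arg_max_def flow_value
    using feasible flow_value_le_charge[where s = s, OF assms(1) _ bounds(1)]
    by (auto simp: not_less)
  then show "welfare ?G s = s 0 1"
    using flow_value by (simp add: welfare_eq_flow_value)
qed

lemma welfare_opt_unprofitable_game:
  assumes "T > 2"
  shows "welfare (unprofitable_game T) (opt_profile (unprofitable_game T)) = 1"
proof -
  let ?G = "unprofitable_game T"
  \<comment> \<open>The partial sums 1, 0, 0, ... use up every battery capacity, so the charge at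
    time 1 is the largest possible.\<close>
  define s :: "nat profile" where "s = (\<lambda>b t. if t = 1 then 1 else if t = 2 then - 1 else 0)"
  have sums: "(\<Sum>z=1..t. s 0 z) = (if t = 1 then 1 else 0)" if "1 \<le> t" for t
    using that
  proof (induction t rule: nat_induct_at_least)
    case base
    then show ?case
      by (simp add: s_def)
  next
    case (Suc n)
    then show ?case
      by (auto simp: s_def)
  qed
  have s: "strategy_profile ?G s"
    by (simp add: strategy_profile_def strategy_def sums del: One_nat_def)
  moreover have "welfare ?G s = 1"
    using welfare_unprofitable_game(1)[OF assms s] by (simp add: s_def)
  \<comment> \<open>One maximizer fixes the welfare of whichever profile \<open>ARG_MAX\<close>
    selects.\<close>
  ultimately show ?thesis
    unfolding opt_profile_def
    using arg_max_equality[of "strategy_profile ?G" s "welfare ?G"] welfare_unprofitable_game[OF assms]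
    by simp
qed

section \<open>Supply-sign prices and equilibria\<close>

lemma supply_sign_prices_unprofitable_game:
  assumes "T > 2"
  shows "p \<in> supply_sign_prices (unprofitable_game T) \<longleftrightarrow> 0 < p 1 \<and> (\<forall>t\<in>{1<..T}. p t = 0)"
proof -
  have "{1..T} = insert 1 {1<..T}"
    using assms by auto
  \<comment> \<open>The totals are 1 - 2 at time 1, -1 + 1 at time 2, and 0 later.\<close>
  moreover have "- sgn (\<Sum>v\<in>verts (unprofitable_game T). net_val (unprofitable_game T) t v) =
      (if t = 1 then 1 else 0)" for t
    by simp
  ultimately show ?thesis
    unfolding supply_sign_prices_def by (auto simp: sgn_1_pos sgn_0_0)
qed

lemma cost_unprofitable_game:
  assumes "T > 2" "p \<in> supply_sign_prices (unprofitable_game T)"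
  shows "(\<Sum>t=1..T. x t * p t) = x 1 * p 1"
proof -
  have "(\<Sum>t=1..T. x t * p t) = x 1 * p 1 + (\<Sum>t\<in>{1<..T}. x t * p t)"
    using assms(1) by (intro sum.head) simp
  then show ?thesis
    using assms by (simp add: supply_sign_prices_unprofitable_game)
qed

lemma welfare_equilibrium_unprofitable_game:
  assumes "T > 2" "p \<in> supply_sign_prices (unprofitable_game T)"
    and "nash_equilibrium (unprofitable_game T) p s"
  shows "welfare (unprofitable_game T) s = 0"
proof -
  let ?G = "unprofitable_game T"
  have s: "strategy_profile ?G s"
    using assms(3) by (simp add: nash_equilibrium_def)
  have "0 \<le> utility ?G 0 s p"
    using battery_instance_unprofitable_game assms(3) by (rule nash_equilibrium_utility_nonneg) simp
  \<comment> \<open>Nonnegativity excludes the value -\<infinity>, so the utility is the finite one,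
    namely \<open>- (s 0 1 * p 1)\<close>.\<close>
  then have "s 0 1 * p 1 \<le> 0"
    using cost_unprofitable_game[OF assms(1,2), of "s 0"]
    by (simp add: utility_def split: if_splits)
  moreover have "0 < p 1"
    using assms(1,2) by (simp add: supply_sign_prices_unprofitable_game)
  ultimately have "s 0 1 \<le> 0"
    by (simp add: mult_le_0_iff)
  then show ?thesis
    using welfare_unprofitable_game[OF assms(1) s] by simp
qed

text \<open>An equilibrium must exist for the instance to count in the supremum. An admissible
  deviation \<open>x\<close> earns \<open>- (x 1 * p 1)\<close>, which is at most 0, and an
  inadmissible one earns -\<infinity>.\<close>

lemma idle_equilibrium_unprofitable_game:
  assumes "T > 2" "p \<in> supply_sign_prices (unprofitable_game T)"
  shows "nash_equilibrium (unprofitable_game T) p (\<lambda>b t. 0)"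
proof -
  let ?G = "unprofitable_game T" and ?s = "\<lambda>b t. 0 :: real"
  have "utility ?G 0 ?s p = 0"
    using utility_idle[of 0 ?G ?s p] by (simp add: fun_upd_idem)
  moreover have "utility ?G 0 (?s(0 := x)) p \<le> 0" if "strategy ?G 0 x" for x
  proof -
    have "0 \<le> x 1"
      using that assms(1) unfolding strategy_def by (auto dest!: bspec[of _ _ 1])
    then show ?thesis
      using cost_unprofitable_game[OF assms, of x] assms
      by (simp add: utility_def supply_sign_prices_unprofitable_game)
  qed
  ultimately show ?thesis
    using strategy_idle[OF battery_instance_unprofitable_game]
    by (auto simp: nash_equilibrium_def strategy_profile_def not_less)
qed

theorem theorem7:
  fixes T :: nat
  assumes "T > 2"
  shows "price_of_stability supply_sign_prices T = \<infinity>"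
proof -
  let ?G = "unprofitable_game T"
  let ?bound = "\<lambda>G. INF p \<in> stable_prices supply_sign_prices G.
      INF s \<in> {s. nash_equilibrium G p s}. ratio (welfare G (opt_profile G)) (welfare G s)"
  have "(\<lambda>t. if t = 1 then 1 else 0) \<in> supply_sign_prices ?G"
    using assms by (simp add: supply_sign_prices_unprofitable_game)
  then have "stable_prices supply_sign_prices ?G \<noteq> {}"
    using idle_equilibrium_unprofitable_game[OF assms] unfolding stable_prices_def by blast
  then have "?bound ?G \<le> price_of_stability supply_sign_prices T"
    unfolding price_of_stability_def
    by (intro SUP_upper) (simp add: battery_instance_unprofitable_game)
  \<comment> \<open>The optimum 1 is compared with 0, where \<open>ratio\<close> is \<infinity> by
    convention.\<close>
  moreover have "ratio (welfare ?G (opt_profile ?G)) (welfare ?G s) = \<infinity>"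
    if "p \<in> stable_prices supply_sign_prices ?G" "nash_equilibrium ?G p s" for p s
    using that welfare_equilibrium_unprofitable_game[OF assms, of p s]
    by (simp add: ratio_def stable_prices_def welfare_opt_unprofitable_game[OF assms])
  then have "\<infinity> \<le> ?bound ?G"
    by (intro INF_greatest) simp
  ultimately have "\<infinity> \<le> price_of_stability supply_sign_prices T"
    by (rule order_trans[rotated])
  then show ?thesis
    by simp
qed

end
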